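(* Let $h\geq 4$ be an integer and let $\overline{\Gamma_{2^h}}=\overline{C_{2^h}(1,2,2^2,\ldots,2^{h-1})}$ be the complement of the circulant graph $C_{2^h}(1,2,2^2,\ldots,2^{h-1})$. Then its vertex-forwarding index is $$\xi(\overline{\Gamma_{2^h}})=2h-1.$$
   Context: For $S\subseteq\mathbb{Z}_n\setminus\{0\}$, the circulant graph $C_n(S)$ is the simple undirected graph with vertex set $\mathbb{Z}_n=\{0,1,\ldots,n-1\}$ and edge set $\{\{g,g+s\}: g\in\mathbb{Z}_n, s\in S\}$ (addition mod $n$); $C_n(s_1,\ldots,s_t)$ means $C_n(\{s_1,\ldots,s_t\})$. $\overline{\Gamma}$ denotes the complement of $\Gamma$. A routing $R$ of a connected graph $\Gamma$ on $n$ vertices is a set of $n(n-1)$ elementary (i.e. simple) paths $R(x,y)$, one from $x$ to $y$ for every ordered pair $(x,y)$ of distinct vertices. The load $\xi_x(\Gamma,R)$ of a vertex $x$ is the number of paths of $R$ having $x$ as an inner (non-end) vertex. Put $\xi(\Gamma,R)=\max_{x\in V(\Gamma)}\xi_x(\Gamma,R)$. The vertex-forwarding index is $\xi(\Gamma)=\min_R \xi(\Gamma,R)$, the minimum over all routings $R$ of $\Gamma$. *)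

theory Defs
  imports Main
begin

record 'a ugraph =
  verts :: "'a set"
  edges :: "'a set set"

text \<open>The group \<open>Z_n\<close> is represented by the residues \<open>0, \<dots>, n - 1\<close>. The connection set is meant to
  satisfy \<open>S \<subseteq> {1..<n}\<close>; then every edge is a two-element set.\<close>

definition circulant :: "nat \<Rightarrow> nat set \<Rightarrow> nat ugraph" where
  "circulant n S =
     \<lparr> verts = {0..<n}, edges = {{g, (g + s) mod n} | g s. g \<in> {0..<n} \<and> s \<in> S} \<rparr>"

definition complement :: "'a ugraph \<Rightarrow> 'a ugraph" where
  "complement G =
     \<lparr> verts = verts G,
       edges = {{u, v} | u v. u \<in> verts G \<and> v \<in> verts G \<and> u \<noteq> v \<and> {u, v} \<notin> edges G} \<rparr>"

text \<open>Elementary paths are given by their lists of vertices.\<close>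

definition elementary_path :: "'a ugraph \<Rightarrow> 'a \<Rightarrow> 'a \<Rightarrow> 'a list \<Rightarrow> bool" where
  "elementary_path G x y p \<longleftrightarrow>
     p \<noteq> [] \<and> hd p = x \<and> last p = y \<and> distinct p \<and> set p \<subseteq> verts G \<and>
     successively (\<lambda>u v. {u, v} \<in> edges G) p"

text \<open>A routing is encoded as the function sending an ordered pair of distinct vertices to the
  chosen path. Its values at other pairs are arbitrary and never used. Paths for different pairs
  have different ends, so counting pairs, as in \<open>load\<close>, is the same as counting paths.\<close>

definition routing :: "'a ugraph \<Rightarrow> ('a \<Rightarrow> 'a \<Rightarrow> 'a list) \<Rightarrow> bool" where
  "routing G R \<longleftrightarrow>
     (\<forall>x \<in> verts G. \<forall>y \<in> verts G. x \<noteq> y \<longrightarrow> elementary_path G x y (R x y))"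

definition load :: "'a ugraph \<Rightarrow> ('a \<Rightarrow> 'a \<Rightarrow> 'a list) \<Rightarrow> 'a \<Rightarrow> nat" where
  "load G R v =
     card {(x, y). x \<in> verts G \<and> y \<in> verts G \<and> x \<noteq> y \<and> v \<in> set (R x y) - {x, y}}"

definition max_load :: "'a ugraph \<Rightarrow> ('a \<Rightarrow> 'a \<Rightarrow> 'a list) \<Rightarrow> nat" where
  "max_load G R = Max (load G R ` verts G)"

text \<open>For a finite, nonempty, connected graph the set below is finite (see
  \<open>finite_max_loads\<close>) and nonempty, so that \<open>Min\<close> is its actual minimum.\<close>

definition vertex_forwarding_index :: "'a ugraph \<Rightarrow> nat" where
  "vertex_forwarding_index G = Min {max_load G R | R. routing G R}"

lemma load_le:
  assumes "finite (verts G)"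
  shows "load G R v \<le> card (verts G) * card (verts G)"
proof -
  have "load G R v \<le> card (verts G \<times> verts G)"
    unfolding load_def using assms by (intro card_mono) auto
  then show ?thesis by (simp add: card_cartesian_product)
qed

lemma finite_max_loads:
  assumes "finite (verts G)" and "verts G \<noteq> {}"
  shows "finite {max_load G R | R. routing G R}"
proof (rule finite_subset)
  show "{max_load G R | R. routing G R} \<subseteq> {..card (verts G) * card (verts G)}"
    using assms by (auto simp: max_load_def intro!: Max.boundedI load_le)
qed simp

end

theory Submission imports Defs begin

text \<open>Write \<open>n = 2 ^ h\<close>, and let \<open>D\<close> be the set of the residues \<open>2 ^ i\<close> and \<open>- 2 ^ i\<close> for \<open>i < h\<close>. In the
  complement graph two distinct vertices are non-adjacent exactly if their difference lies in \<open>D\<close>, and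
  \<open>D\<close> has \<open>2 * h - 1\<close> elements because \<open>2 ^ (h - 1)\<close> is the only coincidence between the two families.

  A path between non-adjacent vertices has at least one inner vertex, so the loads of any routing
  sum to at least the number \<open>n * card D\<close> of ordered non-adjacent pairs; hence some vertex has load
  at least \<open>card D\<close> (\<open>nonadjacent_pairs_le_max_load\<close>). This bound is attained as soon as each \<open>d\<close> in
  \<open>D\<close> is a sum \<open>a + b\<close> of two nonzero residues outside \<open>D\<close>: for \<open>y = x + d\<close> the path \<open>x\<close>, \<open>x + a\<close>,
  \<open>y\<close> is available, and if \<open>a\<close> depends on \<open>d\<close> only, then translation spreads these detours evenly: a
  vertex is the midpoint of exactly one of them for each \<open>d\<close> in \<open>D\<close>
  (\<open>forwarding_index_complement_circulant\<close>).

  It remains to find such decompositions of the powers of two; those of their negatives follow by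
  negation. The multiples \<open>3 * 2 ^ j\<close> and \<open>5 * 2 ^ j\<close> with \<open>j + 3 \<le> h\<close> are outside \<open>D\<close>, since \<open>3\<close> and
  \<open>5\<close> are not \<open>1\<close> or \<open>- 1\<close> modulo \<open>8\<close>, and
  \<open>1 = 6 - 5\<close>, \<open>2 * 2 ^ j = 5 * 2 ^ j - 3 * 2 ^ j\<close> and \<open>8 * 2 ^ j = 5 * 2 ^ j + 3 * 2 ^ j\<close>; the last
  identity is used for \<open>2 ^ (h - 1)\<close>, so with \<open>j = h - 4\<close>.\<close>

section \<open>A lower bound for the load of a routing\<close>

lemma path_between_nonadjacent_has_inner_vertex:
  assumes "elementary_path G x y p" "x \<noteq> y" "{x, y} \<notin> edges G"
  shows "\<exists>v \<in> verts G. v \<in> set p - {x, y}"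
proof -
  obtain q where p: "p = x # q"
    using assms(1) by (cases p) (auto simp: elementary_path_def)
  with assms obtain v r where q: "q = v # r"
    by (cases q) (auto simp: elementary_path_def)
  have "v \<noteq> x" "v \<in> verts G" "{x, v} \<in> edges G"
    using assms(1) by (auto simp: elementary_path_def p q)
  then show ?thesis
    using assms(3) by (auto simp: p q)
qed

text \<open>Double counting: the pairs of a non-adjacent pair and an inner vertex of its path are counted
  once by the loads, and every non-adjacent pair occurs in at least one of them.\<close>

lemma nonadjacent_pairs_le_max_load:
  assumes fin: "finite (verts G)" and R: "routing G R"
  shows "card {(x, y). x \<in> verts G \<and> y \<in> verts G \<and> x \<noteq> y \<and> {x, y} \<notin> edges G}
           \<le> card (verts G) * max_load G R" (is "card ?N \<le> _")
proof -
  let ?L = "\<lambda>v. {(x, y). x \<in> verts G \<and> y \<in> verts G \<and> x \<noteq> y \<and> v \<in> set (R x y) - {x, y}}"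
  have finL: "finite (?L v)" for v
    by (rule finite_subset[of _ "verts G \<times> verts G"]) (use fin in auto)
  have "?N \<subseteq> (\<Union>v \<in> verts G. ?L v)"
  proof (clarify)
    fix x y
    assume xy: "x \<in> verts G" "y \<in> verts G" "x \<noteq> y" "{x, y} \<notin> edges G"
    then have "elementary_path G x y (R x y)"
      using R by (auto simp: routing_def)
    with xy show "(x, y) \<in> (\<Union>v \<in> verts G. ?L v)"
      using path_between_nonadjacent_has_inner_vertex[of G x y "R x y"] by blast
  qed
  then have "card ?N \<le> card (\<Union>v \<in> verts G. ?L v)"
    using fin finL by (intro card_mono) blast+
  also have "\<dots> \<le> (\<Sum>v \<in> verts G. card (?L v))"
    by (rule card_UN_le[OF fin])
  also have "\<dots> = (\<Sum>v \<in> verts G. load G R v)"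
    by (simp add: load_def)
  also have "\<dots> \<le> (\<Sum>v \<in> verts G. max_load G R)"
    using fin by (intro sum_mono) (simp add: max_load_def)
  finally show ?thesis by simp
qed

section \<open>Complements of circulant graphs\<close>

text \<open>For \<open>0 < s < n\<close> the natural number \<open>n - s\<close> is the residue of \<open>- s\<close>, so for \<open>S \<subseteq> {1..<n}\<close> this is
  the set of the differences, in either direction, between adjacent vertices of the circulant graph.\<close>

definition sym_closure :: "nat \<Rightarrow> nat set \<Rightarrow> nat set" where
  "sym_closure n S = S \<union> (\<lambda>s. n - s) ` S"

definition residue_diff :: "nat \<Rightarrow> nat \<Rightarrow> nat \<Rightarrow> nat" where
  "residue_diff n x y = (y + (n - x)) mod n"

lemma mod_if_less_double: "(m::nat) < 2 * n \<Longrightarrow> m mod n = (if m < n then m else m - n)"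
  by (simp add: mod_if)

lemma residue_diff_eq:
  "x < n \<Longrightarrow> y < n \<Longrightarrow> residue_diff n x y = (if x \<le> y then y - x else y + n - x)"
  unfolding residue_diff_def by (subst mod_if_less_double) auto

lemma residue_add_eq:
  "x < n \<Longrightarrow> y < n \<Longrightarrow> (x + y) mod n = (if x + y < n then x + y else x + y - n)" for n :: nat
  by (subst mod_if_less_double) auto

lemma residue_diff_less: "x < n \<Longrightarrow> residue_diff n x y < n"
  by (simp add: residue_diff_def)

lemma residue_diff_add: "x < n \<Longrightarrow> d < n \<Longrightarrow> residue_diff n x ((x + d) mod n) = d"
  by (auto simp: residue_diff_eq residue_add_eq)

lemma residue_add_diff: "x < n \<Longrightarrow> y < n \<Longrightarrow> (x + residue_diff n x y) mod n = y"
  by (subst residue_add_eq) (auto simp: residue_diff_eq)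

lemma residue_add_cancel:
  "x < n \<Longrightarrow> x' < n \<Longrightarrow> c < n \<Longrightarrow> (x + c) mod n = (x' + c) mod n \<Longrightarrow> x = x'" for n :: nat
  by (auto simp: residue_add_eq split: if_splits)

lemma sym_closure_subset:
  "S \<subseteq> {1..<n} \<Longrightarrow> sym_closure n S \<subseteq> {1..<n}"
  by (fastforce simp: sym_closure_def)

lemma sym_closure_minus:
  assumes "S \<subseteq> {1..<n}" "d < n"
  shows "n - d \<in> sym_closure n S \<longleftrightarrow> d \<in> sym_closure n S"
proof -
  have "n - d \<in> sym_closure n S" if "d \<in> sym_closure n S" for d
    using that assms(1) by (fastforce simp: sym_closure_def)
  from this[of d] this[of "n - d"] show ?thesis
    using assms(2) by auto
qed

lemma circulant_adjacent_iff:
  assumes S: "S \<subseteq> {1..<n}" and x: "x < n" and y: "y < n"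
  shows "{x, y} \<in> edges (circulant n S) \<longleftrightarrow> residue_diff n x y \<in> sym_closure n S"
proof
  assume "{x, y} \<in> edges (circulant n S)"
  then obtain g s where gs: "{x, y} = {g, (g + s) mod n}" "g < n" "s \<in> S"
    by (auto simp: circulant_def)
  have s: "0 < s" "s < n" using gs S by auto
  from gs(1) consider "x = g" "y = (g + s) mod n" | "y = g" "x = (g + s) mod n"
    by (auto simp: doubleton_eq_iff)
  then show "residue_diff n x y \<in> sym_closure n S"
  proof cases
    case 1
    then show ?thesis using gs s by (simp add: residue_diff_add sym_closure_def)
  next
    case 2
    then have "residue_diff n x y = n - s"
      using gs s by (auto simp: residue_diff_eq residue_add_eq)
    then show ?thesis using gs by (simp add: sym_closure_def)
  qed
next
  assume "residue_diff n x y \<in> sym_closure n S"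
  then consider "residue_diff n x y \<in> S" | s where "s \<in> S" "residue_diff n x y = n - s"
    by (auto simp: sym_closure_def)
  then show "{x, y} \<in> edges (circulant n S)"
  proof cases
    case 1
    have "{x, y} = {x, (x + residue_diff n x y) mod n}"
      using x y by (simp add: residue_add_diff)
    then show ?thesis using 1 x by (auto simp: circulant_def)
  next
    case 2
    have "0 < s" "s < n" using 2 S by auto
    then have "x = (y + s) mod n"
      using 2 x y by (auto simp: residue_diff_eq residue_add_eq split: if_splits)
    then have "{x, y} = {y, (y + s) mod n}" by auto
    then show ?thesis using 2 y by (auto simp: circulant_def)
  qed
qed

lemma complement_circulant_adjacent_iff:
  assumes "S \<subseteq> {1..<n}" "x < n" "y < n"
  shows "{x, y} \<in> edges (complement (circulant n S))
           \<longleftrightarrow> x \<noteq> y \<and> residue_diff n x y \<notin> sym_closure n S"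
proof -
  have "{x, y} \<in> edges (complement (circulant n S))
          \<longleftrightarrow> x \<noteq> y \<and> {x, y} \<notin> edges (circulant n S)"
    using assms(2,3) by (auto simp: complement_def circulant_def doubleton_eq_iff insert_commute)
  then show ?thesis
    using circulant_adjacent_iff[OF assms] by simp
qed

lemma verts_complement_circulant [simp]: "verts (complement (circulant n S)) = {0..<n}"
  by (simp add: complement_def circulant_def)

lemma card_nonadjacent_pairs_ge:
  assumes S: "S \<subseteq> {1..<n}"
  shows "n * card (sym_closure n S)
           \<le> card {(x, y). x < n \<and> y < n \<and> x \<noteq> y
                           \<and> {x, y} \<notin> edges (complement (circulant n S))}" (is "_ \<le> card ?N")
proof -
  let ?D = "sym_closure n S"
  let ?f = "\<lambda>(x, d). (x, (x + d) mod n)"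
  have D: "?D \<subseteq> {1..<n}" by (rule sym_closure_subset[OF S])
  have "inj_on ?f ({0..<n} \<times> ?D)"
  proof (rule inj_onI, clarsimp)
    fix x d e
    assume x: "x < n" and de: "d \<in> ?D" "e \<in> ?D" and eq: "(x + d) mod n = (x + e) mod n"
    then have "d < n" "e < n" using D by auto
    then show "d = e"
      using residue_diff_add[OF x] eq by metis
  qed
  moreover have "(x, (x + d) mod n) \<in> ?N" if x: "x < n" and d: "d \<in> ?D" for x d
  proof -
    have "0 < d" "d < n" using d D by auto
    then have "x \<noteq> (x + d) mod n"
      using x by (auto simp: residue_add_eq)
    with x d \<open>d < n\<close> show ?thesis
      by (simp add: complement_circulant_adjacent_iff[OF S] residue_diff_add)
  qed
  then have "?f ` ({0..<n} \<times> ?D) \<subseteq> ?N" by fastforce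
  moreover have "finite ?N"
    by (rule finite_subset[of _ "{0..<n} \<times> {0..<n}"]) auto
  ultimately have "card ({0..<n} \<times> ?D) \<le> card ?N"
    by (rule card_inj_on_le)
  then show ?thesis by (simp add: card_cartesian_product)
qed

text \<open>The choice of a detour depends on the difference \<open>d\<close> alone, so a vertex \<open>v\<close> and a
  difference \<open>d\<close> determine the only pair with this difference that is routed through \<open>v\<close>.\<close>

lemma balanced_routing_exists:
  assumes S: "S \<subseteq> {1..<n}"
    and dec: "\<And>d. d \<in> sym_closure n S \<Longrightarrow>
      \<exists>a b. a \<in> {1..<n} - sym_closure n S \<and> b \<in> {1..<n} - sym_closure n S \<and> (a + b) mod n = d"
  shows "\<exists>R. routing (complement (circulant n S)) R
             \<and> (\<forall>v. load (complement (circulant n S)) R v \<le> card (sym_closure n S))"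
proof -
  let ?D = "sym_closure n S"
  let ?G = "complement (circulant n S)"
  have D: "?D \<subseteq> {1..<n}" by (rule sym_closure_subset[OF S])
  then have finD: "finite ?D" by (rule finite_subset) simp
  obtain c c' where c: "\<And>d. d \<in> ?D \<Longrightarrow>
      c d \<in> {1..<n} - ?D \<and> c' d \<in> {1..<n} - ?D \<and> (c d + c' d) mod n = d"
    using dec by metis
  define R where "R x y = (if residue_diff n x y \<in> ?D
      then [x, (x + c (residue_diff n x y)) mod n, y] else [x, y])" for x y
  have "routing ?G R"
    unfolding routing_def
  proof (intro ballI impI)
    fix x y
    assume "x \<in> verts ?G" "y \<in> verts ?G" and neq: "x \<noteq> y"
    then have xy: "x < n" "y < n" by auto
    show "elementary_path ?G x y (R x y)"
    proof (cases "residue_diff n x y \<in> ?D")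
      case False
      then have "{x, y} \<in> edges ?G"
        using xy neq by (simp add: complement_circulant_adjacent_iff[OF S])
      then show ?thesis
        using False xy neq by (simp add: R_def elementary_path_def)
    next
      case True
      let ?d = "residue_diff n x y"
      let ?z = "(x + c ?d) mod n"
      have c1: "c ?d < n" "0 < c ?d" "c ?d \<notin> ?D" and c2: "c' ?d < n" "0 < c' ?d" "c' ?d \<notin> ?D"
        and sum: "(c ?d + c' ?d) mod n = ?d"
        using c[OF True] by auto
      have z: "?z < n" using xy by simp
      have xz: "x \<noteq> ?z" using xy c1 by (auto simp: residue_add_eq)
      have "y = (x + ?d) mod n" using xy by (simp add: residue_add_diff)
      also have "\<dots> = (x + (c ?d + c' ?d)) mod n"
        by (subst sum[symmetric]) (simp add: mod_simps)
      also have "\<dots> = (?z + c' ?d) mod n" by (simp add: mod_simps add.assoc)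
      finally have y: "y = (?z + c' ?d) mod n" .
      have dxz: "residue_diff n x ?z = c ?d" using xy c1 by (simp add: residue_diff_add)
      have "residue_diff n ?z ((?z + c' ?d) mod n) = c' ?d"
        by (rule residue_diff_add[OF z c2(1)])
      then have dzy: "residue_diff n ?z y = c' ?d" by (simp only: y[symmetric])
      have zy: "?z \<noteq> y"
      proof
        assume "?z = y"
        then have "residue_diff n y y = c' ?d" using dzy by (simp only:)
        then show False using xy c2(2) by (simp add: residue_diff_eq)
      qed
      have "{x, ?z} \<in> edges ?G" "{?z, y} \<in> edges ?G"
        using xz zy dxz dzy c1 c2
        by (simp_all only: complement_circulant_adjacent_iff[OF S] xy z simp_thms)
      then show ?thesis
        using True xy z xz zy neq by (simp add: R_def elementary_path_def)
    qed
  qed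
  moreover have "load ?G R v \<le> card ?D" for v
  proof -
    let ?L = "{(x, y). x \<in> verts ?G \<and> y \<in> verts ?G \<and> x \<noteq> y \<and> v \<in> set (R x y) - {x, y}}"
    let ?diff = "\<lambda>(x, y). residue_diff n x y"
    have L: "x < n \<and> y < n \<and> residue_diff n x y \<in> ?D \<and> v = (x + c (residue_diff n x y)) mod n"
      if "(x, y) \<in> ?L" for x y
      using that by (auto simp: R_def split: if_splits)
    have "inj_on ?diff ?L"
    proof (rule inj_onI)
      fix p q
      assume p: "p \<in> ?L" and q: "q \<in> ?L" and eq: "?diff p = ?diff q"
      obtain x y x' y' where pq: "p = (x, y)" "q = (x', y')"
        by (cases p, cases q)
      have 1: "x < n" "y < n" "residue_diff n x y \<in> ?D" "v = (x + c (residue_diff n x y)) mod n"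
        using L[OF p[unfolded pq]] by blast+
      have same_diff: "residue_diff n x y = residue_diff n x' y'" using eq pq by simp
      have 2: "x' < n" "y' < n" "v = (x' + c (residue_diff n x y)) mod n"
        using L[OF q[unfolded pq]] by (simp_all only: same_diff)
      have "c (residue_diff n x y) < n" using c[OF 1(3)] by auto
      then have "x = x'"
        using 1 2 by (intro residue_add_cancel[of x n x' "c (residue_diff n x y)"]) auto
      moreover have "y = y'"
        using residue_add_diff[OF 1(1,2)] residue_add_diff[OF 2(1,2)] same_diff \<open>x = x'\<close>
        by metis
      ultimately show "p = q" using pq by simp
    qed
    moreover have "?diff ` ?L \<subseteq> ?D"
      by (rule image_subsetI) (use L in \<open>metis (no_types, lifting) case_prod_conv surj_pair\<close>)
    ultimately show ?thesis
      unfolding load_def by (rule card_inj_on_le[OF _ _ finD])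
  qed
  ultimately show ?thesis by blast
qed

theorem forwarding_index_complement_circulant:
  assumes n: "n > 0" and S: "S \<subseteq> {1..<n}"
    and dec: "\<And>d. d \<in> sym_closure n S \<Longrightarrow>
      \<exists>a b. a \<in> {1..<n} - sym_closure n S \<and> b \<in> {1..<n} - sym_closure n S \<and> (a + b) mod n = d"
  shows "vertex_forwarding_index (complement (circulant n S)) = card (sym_closure n S)"
proof -
  let ?D = "sym_closure n S"
  let ?G = "complement (circulant n S)"
  have lower: "card ?D \<le> max_load ?G R" if "routing ?G R" for R
  proof -
    have "n * card ?D
        \<le> card {(x, y). x \<in> verts ?G \<and> y \<in> verts ?G \<and> x \<noteq> y \<and> {x, y} \<notin> edges ?G}"
      using card_nonadjacent_pairs_ge[OF S] by simp
    also have "\<dots> \<le> card (verts ?G) * max_load ?G R"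
      by (rule nonadjacent_pairs_le_max_load[OF _ that]) simp
    finally show ?thesis using n by simp
  qed
  obtain R where R: "routing ?G R" "\<And>v. load ?G R v \<le> card ?D"
    using balanced_routing_exists[OF S dec] by blast
  have "max_load ?G R \<le> card ?D"
    unfolding max_load_def using R(2) n by (intro Max.boundedI) auto
  with lower[OF R(1)] have "max_load ?G R = card ?D" by simp
  with R(1) have "card ?D \<in> {max_load ?G R | R. routing ?G R}"
    by (metis (mono_tags, lifting) mem_Collect_eq)
  then show ?thesis
    unfolding vertex_forwarding_index_def
    using n lower by (intro Min_eqI finite_max_loads) auto
qed

section \<open>Signed powers of two modulo a power of two\<close>

lemma powers_of_two_subset: "{2 ^ i | i. i < h} \<subseteq> {1..<2 ^ h :: nat}"
  by auto

text \<open>The power \<open>2 ^ (h - 1)\<close> is its own negative, and no other residue occurs in both families: two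
  powers below \<open>2 ^ h\<close> are at most \<open>2 ^ (h - 1)\<close> each, so they sum to \<open>2 ^ h\<close> only if both are
  equal to that bound.\<close>

lemma card_sym_closure_powers_of_two:
  assumes "h > 0"
  shows "card (sym_closure (2 ^ h) {2 ^ i | i. i < h}) = 2 * h - 1"
proof -
  let ?S = "{2 ^ i | i. i < h} :: nat set"
  let ?N = "(\<lambda>s. 2 ^ h - s) ` ?S"
  have S: "?S = (\<lambda>i. 2 ^ i) ` {..<h}" by auto
  have cS: "card ?S = h" unfolding S by (subst card_image) (auto simp: inj_on_def)
  have "inj_on (\<lambda>s. 2 ^ h - s) ?S"
  proof (rule inj_onI)
    fix s t
    assume "s \<in> ?S" "t \<in> ?S" and eq: "2 ^ h - s = 2 ^ h - t"
    then have "s < 2 ^ h" "t < 2 ^ h" using powers_of_two_subset by force+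
    with eq show "s = t" by arith
  qed
  then have cN: "card ?N = h" by (simp add: card_image cS)
  have top: "(2::nat) ^ h = 2 ^ (h - 1) + 2 ^ (h - 1)"
    using assms by (cases h) auto
  have "?S \<inter> ?N = {2 ^ (h - 1)}"
  proof (intro equalityI subsetI)
    fix x assume "x \<in> ?S \<inter> ?N"
    then obtain i j where ij: "i < h" "j < h" "x = 2 ^ i" "x = 2 ^ h - 2 ^ j" by auto
    have "(2::nat) ^ i \<le> 2 ^ (h - 1)" "(2::nat) ^ j \<le> 2 ^ (h - 1)"
      using ij by (auto intro!: power_increasing)
    then have "x = 2 ^ (h - 1)" using ij(3,4) top by linarith
    then show "x \<in> {2 ^ (h - 1)}" by simp
  next
    fix x :: nat assume "x \<in> {2 ^ (h - 1)}"
    then have x: "x = 2 ^ (h - 1)" by simp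
    then have "x \<in> ?S" using assms by auto
    moreover have "x = 2 ^ h - x" using x top by simp
    ultimately show "x \<in> ?S \<inter> ?N" by blast
  qed
  moreover have "finite ?S" "finite ?N" by (auto simp: S)
  ultimately show ?thesis
    using card_Un_Int[of ?S ?N] cS cN by (simp add: sym_closure_def)
qed

text \<open>For odd \<open>k\<close>, parity forces a signed power of two equal to \<open>k * 2 ^ j\<close> to be \<open>2 ^ j\<close> or
  \<open>- 2 ^ j\<close>. Then \<open>k\<close> is \<open>1\<close> or \<open>- 1\<close> modulo \<open>2 ^ (h - j)\<close>. As \<open>8\<close> divides
  this modulus, neither \<open>3\<close> nor \<open>5\<close> qualifies.\<close>

lemma odd_multiple_not_signed_power:
  assumes k: "k = 3 \<or> k = 5" and j: "j + 3 \<le> h"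
  shows "k * 2 ^ j \<in> {1..<2 ^ h} - sym_closure (2 ^ h) {2 ^ i | i. i < h}"
    and "2 ^ h - k * 2 ^ j \<in> {1..<2 ^ h} - sym_closure (2 ^ h) {2 ^ i | i. i < h}"
proof -
  let ?D = "sym_closure (2 ^ h) {2 ^ i | i. i < h} :: nat set"
  obtain m where h: "h = j + 3 + m" using j le_Suc_ex by blast
  have pow: "(2::nat) ^ h = 8 * 2 ^ m * 2 ^ j" by (simp add: h power_add)
  have "k * 2 ^ j < 8 * 2 ^ j" using k by auto
  also have "\<dots> \<le> 2 ^ h" by (simp add: pow)
  finally have less: "k * 2 ^ j < 2 ^ h" .
  have pos: "0 < k * 2 ^ j" using k by auto
  have "odd k" using k by auto
  have "k * 2 ^ j \<notin> ?D"
  proof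
    assume "k * 2 ^ j \<in> ?D"
    then obtain i where i: "i < h" and "k * 2 ^ j = 2 ^ i \<or> k * 2 ^ j = 2 ^ h - 2 ^ i"
      by (auto simp: sym_closure_def)
    moreover have "(2::nat) ^ i < 2 ^ h" using i by simp
    ultimately have cases: "k * 2 ^ j = 2 ^ i \<or> k * 2 ^ j + 2 ^ i = 2 ^ h" by arith
    consider "i < j" | "i = j" | "j < i" by linarith
    then show False
    proof cases
      case 1
      then obtain l where l: "j = Suc (i + l)" using less_imp_Suc_add by blast
      have "k * (2 * 2 ^ l) * 2 ^ i = 1 * 2 ^ i \<or>
          (k * (2 * 2 ^ l) + 1) * 2 ^ i = (8 * 2 ^ m * (2 * 2 ^ l)) * 2 ^ i"
        using cases by (simp add: pow l power_add algebra_simps)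
      then have "k * (2 * 2 ^ l) = 1 \<or> k * (2 * 2 ^ l) + 1 = 8 * 2 ^ m * (2 * 2 ^ l)"
        unfolding mult_cancel2 by simp
      moreover have "even (k * (2 * 2 ^ l))" "even (8 * 2 ^ m * (2 * 2 ^ l) :: nat)" by simp_all
      ultimately show False by (metis even_plus_one_iff odd_one)
    next
      case 2
      have "k * 2 ^ j = 1 * 2 ^ j \<or> (k + 1) * 2 ^ j = (8 * 2 ^ m) * 2 ^ j"
        using cases by (simp add: pow 2 algebra_simps)
      then have "k = 1 \<or> k + 1 = 8 * 2 ^ m"
        unfolding mult_cancel2 by simp
      then have "k + 1 = 8 * 2 ^ m" using k by auto
      then have "8 dvd k + 1" by (metis dvd_triv_left)
      then show False using k by auto
    next
      case 3
      then obtain l where l: "i = Suc (j + l)" using less_imp_Suc_add by blast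
      have "k * 2 ^ j = (2 * 2 ^ l) * 2 ^ j \<or> (k + 2 * 2 ^ l) * 2 ^ j = (8 * 2 ^ m) * 2 ^ j"
        using cases by (simp add: pow l power_add algebra_simps)
      then have "k = 2 * 2 ^ l \<or> k + 2 * 2 ^ l = 8 * 2 ^ m"
        unfolding mult_cancel2 by simp
      moreover have "even (2 * 2 ^ l :: nat)" "even (8 * 2 ^ m :: nat)" by simp_all
      ultimately show False using \<open>odd k\<close> by (metis even_add)
    qed
  qed
  moreover from this have "2 ^ h - k * 2 ^ j \<notin> ?D"
    using sym_closure_minus[OF powers_of_two_subset less] by simp
  ultimately show "k * 2 ^ j \<in> {1..<2 ^ h} - ?D" "2 ^ h - k * 2 ^ j \<in> {1..<2 ^ h} - ?D"
    using less pos by auto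
qed

text \<open>The two smallest admissible odd multipliers \<open>3\<close> and \<open>5\<close> differ by \<open>2\<close> and sum to \<open>8\<close>. The
  difference \<open>5 * 2 ^ j - 3 * 2 ^ j\<close> gives \<open>2 ^ i\<close> with \<open>i = j + 1\<close>, which leaves the two extreme
  exponents: the bound \<open>j + 3 \<le> h\<close> excludes \<open>i = h - 1\<close>, where the sum is used, and \<open>i = 0\<close> has no
  \<open>j\<close>, so there \<open>1 = 6 - 5\<close> is used. Both of these need \<open>h \<ge> 4\<close>.\<close>

lemma power_of_two_decomposition:
  fixes h i :: nat
  defines "D \<equiv> sym_closure (2 ^ h) {2 ^ i | i. i < h}"
  assumes h: "h \<ge> 4" and i: "i < h"
  shows "\<exists>a b. a \<in> {1..<2 ^ h} - D \<and> b \<in> {1..<2 ^ h} - D \<and> (a + b) mod 2 ^ h = 2 ^ i"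
proof -
  have less: "(2::nat) ^ i < 2 ^ h" using i by simp
  note outside = odd_multiple_not_signed_power[where h = h, folded D_def]
  consider "i = 0" | "0 < i" "i < h - 1" | "i = h - 1" using i by linarith
  then show ?thesis
  proof cases
    case 1
    have a: "3 * 2 ^ 1 \<in> {1..<2 ^ h} - D" and b: "2 ^ h - 5 * 2 ^ 0 \<in> {1..<2 ^ h} - D"
      using outside(1)[of 3 1] outside(2)[of 5 0] h by simp_all
    have "5 * 2 ^ 0 < (2::nat) ^ h" using outside(1)[of 5 0] h by simp
    then have "3 * 2 ^ 1 + (2 ^ h - 5 * 2 ^ 0) = 2 ^ i + (2::nat) ^ h" using 1 by simp
    then have "(3 * 2 ^ 1 + (2 ^ h - 5 * 2 ^ 0)) mod 2 ^ h = (2::nat) ^ i"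
      using less by (simp only: mod_add_self2 mod_less)
    with a b show ?thesis by blast
  next
    case 2
    then obtain j where j: "i = Suc j" "j + 3 \<le> h" by (cases i) auto
    have a: "5 * 2 ^ j \<in> {1..<2 ^ h} - D" and b: "2 ^ h - 3 * 2 ^ j \<in> {1..<2 ^ h} - D"
      using outside(1)[of 5 j] outside(2)[of 3 j] j by simp_all
    have "3 * 2 ^ j < (2::nat) ^ h" using outside(1)[of 3 j] j by simp
    then have "5 * 2 ^ j + (2 ^ h - 3 * 2 ^ j) = 2 ^ i + (2::nat) ^ h" using j by simp
    then have "(5 * 2 ^ j + (2 ^ h - 3 * 2 ^ j)) mod 2 ^ h = (2::nat) ^ i"
      using less by (simp only: mod_add_self2 mod_less)
    with a b show ?thesis by blast
  next
    case 3
    obtain j where j: "h = j + 4" using h le_Suc_ex[of 4 h] by auto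
    have ab: "5 * 2 ^ j \<in> {1..<2 ^ h} - D" "3 * 2 ^ j \<in> {1..<2 ^ h} - D"
      using outside(1)[of 5 j] outside(1)[of 3 j] j by simp_all
    have "5 * 2 ^ j + 3 * 2 ^ j = (2::nat) ^ i" using 3 j by (simp add: power_add)
    then have "(5 * 2 ^ j + 3 * 2 ^ j) mod 2 ^ h = (2::nat) ^ i"
      using less by (simp only: mod_less)
    with ab show ?thesis by blast
  qed
qed

lemma decomposition_minus:
  assumes S: "S \<subseteq> {1..<n}" and s: "s \<in> S"
    and a: "a \<in> {1..<n} - sym_closure n S" and b: "b \<in> {1..<n} - sym_closure n S"
    and sum: "(a + b) mod n = s"
  shows "n - a \<in> {1..<n} - sym_closure n S" "n - b \<in> {1..<n} - sym_closure n S"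
    "((n - a) + (n - b)) mod n = n - s"
proof -
  show "n - a \<in> {1..<n} - sym_closure n S" "n - b \<in> {1..<n} - sym_closure n S"
    using a b sym_closure_minus[OF S] by auto
  show "((n - a) + (n - b)) mod n = n - s"
    using a b s S sum
    by (subst residue_add_eq) (auto simp: residue_add_eq split: if_splits)
qed

theorem corollary5p4:
  fixes h :: nat
  assumes "h \<ge> 4"
  shows "vertex_forwarding_index (complement (circulant (2 ^ h) {2 ^ i | i. i \<in> {0..h - 1}})) = 2 * h - 1"
proof -
  let ?S = "{2 ^ i | i. i < h} :: nat set"
  have "i \<in> {0..h - 1} \<longleftrightarrow> i < h" for i using assms by auto
  then have S: "{2 ^ i | i. i \<in> {0..h - 1}} = ?S" by simp
  have "\<exists>a b. a \<in> {1..<2 ^ h} - sym_closure (2 ^ h) ?S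
      \<and> b \<in> {1..<2 ^ h} - sym_closure (2 ^ h) ?S \<and> (a + b) mod 2 ^ h = d"
    if "d \<in> sym_closure (2 ^ h) ?S" for d
  proof -
    obtain i where i: "i < h" and d: "d = 2 ^ i \<or> d = 2 ^ h - 2 ^ i"
      using \<open>d \<in> sym_closure (2 ^ h) ?S\<close> by (auto simp: sym_closure_def)
    obtain a b where ab: "a \<in> {1..<2 ^ h} - sym_closure (2 ^ h) ?S"
        "b \<in> {1..<2 ^ h} - sym_closure (2 ^ h) ?S" "(a + b) mod 2 ^ h = 2 ^ i"
      using power_of_two_decomposition[OF assms i] by blast
    have "2 ^ i \<in> ?S" using i by blast
    note neg = decomposition_minus[OF powers_of_two_subset this ab]
    show ?thesis using d ab neg by blast
  qed
  then have "vertex_forwarding_index (complement (circulant (2 ^ h) ?S))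
      = card (sym_closure (2 ^ h) ?S)"
    by (intro forwarding_index_complement_circulant powers_of_two_subset) auto
  then show ?thesis
    using card_sym_closure_powers_of_two[of h] assms by (simp only: S)
qed

end
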